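(* Let $T$ be a P1-win tree with radius $r$. If $T$ has a single central vertex $c$, then $\deg(c) = 3$, and for some neighbor $x$ of $c$: (i) the component of $T - \{cx\}$ containing $x$ has diameter at most $r$, and (ii) the component of $T - \{cx\}$ containing $c$ has exactly one central vertex, namely $c$. If $T$ has two central vertices $c_1$ and $c_2$ with $\deg(c_1) \ge \deg(c_2)$, then $\deg(c_1) = 3$ and $\deg(c_2) = 2$, and moreover: (iii) the component of $T - \{c_1c_2\}$ containing $c_2$ has diameter at most $r-1$, and (iv) the component of $T - \{c_1c_2\}$ containing $c_1$ has exactly one central vertex, namely $c_1$.
   Context: Trail Trap on a finite simple undirected graph $G$: Player 1 (P1) chooses a vertex, places a token on it and moves it along an incident edge $e$ to the other endpoint. Player 2 (P2) then places their own token on any vertex and moves it along an incident edge $f \neq e$. Thereafter the players alternate, starting with P1, each moving their own token from its current vertex along an unused edge (an edge not previously traversed, in either direction, by either player) to the adjacent vertex; vertices may be revisited and the two tokens may share a vertex. The first player unable to move loses. $G$ is P1-win if P1 has a winning strategy. The eccentricity of $v$ is $\max_x d(v,x)$; the radius is the minimum eccentricity, the diameter the maximum; a central vertex is one of minimum eccentricity (in the relevant graph). $T - \{e\}$ denotes $T$ with edge $e$ deleted.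
   Formalization: The tree with two vertices and a single edge is excluded: there P1 uses the only edge and P2 cannot move, so it is P1-win, but both of its central vertices have degree 1 and the claim fails. *)

theory Defs
  imports Main
begin

section \<open>Finite simple graphs and trees\<close>

datatype 'a graph = Graph (verts: "'a set") (edges: "'a set set")

definition simple_graph :: "'a graph \<Rightarrow> bool" where
  "simple_graph G \<longleftrightarrow> finite (verts G) \<and> (\<forall>e\<in>edges G. e \<subseteq> verts G \<and> card e = 2)"

definition degree :: "'a graph \<Rightarrow> 'a \<Rightarrow> nat" where
  "degree G v = card {e \<in> edges G. v \<in> e}"

text \<open>A walk is its nonempty list of vertices, so its number of edges is one less than the
  length of the list.\<close>

definition walk :: "'a graph \<Rightarrow> 'a list \<Rightarrow> bool" where
  "walk G p \<longleftrightarrow> p \<noteq> [] \<and> set p \<subseteq> verts G \<and> successively (\<lambda>u v. {u, v} \<in> edges G) p"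

definition walk_betw :: "'a graph \<Rightarrow> 'a \<Rightarrow> 'a list \<Rightarrow> 'a \<Rightarrow> bool" where
  "walk_betw G u p v \<longleftrightarrow> walk G p \<and> hd p = u \<and> last p = v"

definition connected_graph :: "'a graph \<Rightarrow> bool" where
  "connected_graph G \<longleftrightarrow>
     verts G \<noteq> {} \<and> (\<forall>u\<in>verts G. \<forall>v\<in>verts G. \<exists>p. walk_betw G u p v)"

definition cycle :: "'a graph \<Rightarrow> 'a list \<Rightarrow> bool" where
  "cycle G p \<longleftrightarrow> walk G p \<and> distinct p \<and> length p \<ge> 3 \<and> {last p, hd p} \<in> edges G"

definition tree :: "'a graph \<Rightarrow> bool" where
  "tree G \<longleftrightarrow> simple_graph G \<and> connected_graph G \<and> (\<nexists>p. cycle G p)"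

definition delete_edge :: "'a graph \<Rightarrow> 'a set \<Rightarrow> 'a graph" where
  "delete_edge G e = Graph (verts G) (edges G - {e})"

definition component :: "'a graph \<Rightarrow> 'a \<Rightarrow> 'a graph" where
  "component G x =
     (let C = {y. \<exists>p. walk_betw G x p y} in Graph C {e \<in> edges G. e \<subseteq> C})"

section \<open>Distances\<close>

text \<open>Distances, and the notions derived from them, are only meaningful on finite connected
  graphs, which is how they are used.\<close>

definition graph_dist :: "'a graph \<Rightarrow> 'a \<Rightarrow> 'a \<Rightarrow> nat" where
  "graph_dist G u v = (LEAST n. \<exists>p. walk_betw G u p v \<and> length p = Suc n)"

definition eccentricity :: "'a graph \<Rightarrow> 'a \<Rightarrow> nat" where
  "eccentricity G v = Max ((\<lambda>x. graph_dist G v x) ` verts G)"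

definition radius :: "'a graph \<Rightarrow> nat" where
  "radius G = Min (eccentricity G ` verts G)"

definition diameter :: "'a graph \<Rightarrow> nat" where
  "diameter G = Max (eccentricity G ` verts G)"

definition central_vertices :: "'a graph \<Rightarrow> 'a set" where
  "central_vertices G = {v \<in> verts G. eccentricity G v = radius G}"

section \<open>Trail Trap\<close>

text \<open>A move \<open>(u, v)\<close> takes the mover's token from \<open>u\<close> to \<open>v\<close>. A history lists all moves made
  so far in chronological order; Player 1 makes the moves at even positions (counting from 0),
  Player 2 those at odd positions. The first move of each player includes the placement of the
  token, so its starting vertex is unrestricted; from then on a player's move starts where that
  player's previous move, two positions earlier, ended. Placing a token on a vertex without an
  unused incident edge is an immediate loss and is not represented as a separate option.\<close>

type_synonym 'a move = "'a \<times> 'a"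

definition used_edges :: "'a move list \<Rightarrow> 'a set set" where
  "used_edges h = (\<lambda>(u, v). {u, v}) ` set h"

definition legal_move :: "'a graph \<Rightarrow> 'a move list \<Rightarrow> 'a move \<Rightarrow> bool" where
  "legal_move G h m \<longleftrightarrow>
     {fst m, snd m} \<in> edges G - used_edges h \<and>
     (length h \<ge> 2 \<longrightarrow> fst m = snd (h ! (length h - 2)))"

definition play :: "'a graph \<Rightarrow> 'a move list \<Rightarrow> bool" where
  "play G h \<longleftrightarrow> (\<forall>i<length h. legal_move G (take i h) (h ! i))"

definition complete_play :: "'a graph \<Rightarrow> 'a move list \<Rightarrow> bool" where
  "complete_play G h \<longleftrightarrow> play G h \<and> (\<nexists>m. legal_move G h m)"

definition P1_strategy :: "'a graph \<Rightarrow> ('a move list \<Rightarrow> 'a move) \<Rightarrow> bool" where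
  "P1_strategy G \<sigma> \<longleftrightarrow>
     (\<forall>h. play G h \<and> even (length h) \<and> (\<exists>m. legal_move G h m) \<longrightarrow> legal_move G h (\<sigma> h))"

definition follows_P1 :: "('a move list \<Rightarrow> 'a move) \<Rightarrow> 'a move list \<Rightarrow> bool" where
  "follows_P1 \<sigma> h \<longleftrightarrow> (\<forall>i<length h. even i \<longrightarrow> h ! i = \<sigma> (take i h))"

text \<open>Player 1 wins a complete play iff Player 2 is the one who cannot move at its end, that is,
  iff its number of moves is odd.\<close>

definition P1_win :: "'a graph \<Rightarrow> bool" where
  "P1_win G \<longleftrightarrow>
     (\<exists>\<sigma>. P1_strategy G \<sigma> \<and>
        (\<forall>h. complete_play G h \<and> follows_P1 \<sigma> h \<longrightarrow> odd (length h)))"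

end

theory Submission
  imports Defs
begin

text \<open>Suppose Player 1 wins with the opening move from \<open>u\<close> to \<open>v\<close>, and let \<open>n\<close> be the length of a
  longest path that starts at \<open>v\<close> and avoids the edge \<open>uv\<close>. Player 2 wins as soon as the tokens lie
  in different components of the graph of unused edges and Player 2's token starts an unused path
  at least as long as any that Player 1's token starts. Three replies create such a race:
  walking along a path of length \<open>n + 1\<close> on the side of \<open>u\<close>; walking from \<open>v\<close> into the branch
  of height \<open>n\<close> at \<open>v\<close>, if there is only one; moving to \<open>v\<close> from its neighbour in a third branch and then
  entering whichever of two branches of height \<open>n\<close> Player 1 does not enter.
  Hence \<open>v\<close> has exactly two branches besides \<open>u\<close>, both of height \<open>n\<close>, and the side of
  \<open>u\<close> has diameter at most \<open>n\<close>, which determines the centre of the tree.\<close>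

section \<open>Paths in forests\<close>

abbreviation (input) adj :: "'a set set \<Rightarrow> 'a \<Rightarrow> 'a \<Rightarrow> bool" where
  "adj E \<equiv> (\<lambda>u v. {u, v} \<in> E)"

abbreviation conn :: "'a set set \<Rightarrow> 'a \<Rightarrow> 'a \<Rightarrow> bool" where
  "conn E \<equiv> (adj E)\<^sup>*\<^sup>*"

text \<open>Stated for a bare edge set, because the game keeps deleting edges while the vertices
  stay. A one-vertex list is always a path, and \<open>length\<close> counts vertices, one more than
  the number of edges.\<close>

definition path :: "'a set set \<Rightarrow> 'a list \<Rightarrow> bool" where
  "path E p \<longleftrightarrow> p \<noteq> [] \<and> distinct p \<and> successively (adj E) p"

definition forest :: "'a set set \<Rightarrow> bool" where
  "forest E \<longleftrightarrow> (\<forall>e\<in>E. card e = 2) \<and>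
     (\<nexists>p. path E p \<and> length p \<ge> 3 \<and> {last p, hd p} \<in> E)"

lemma path_Cons:
  "path E (x # p) \<longleftrightarrow> p = [] \<or> path E p \<and> x \<notin> set p \<and> {x, hd p} \<in> E"
  by (cases p) (auto simp: path_def)

lemma path_singleton [simp]: "path E [x]"
  by (simp add: path_def)

lemma not_path_Nil [simp]: "\<not> path E []"
  by (simp add: path_def)

lemma path_mono: "path E p \<Longrightarrow> E \<subseteq> E' \<Longrightarrow> path E' p"
  by (auto simp: path_def elim: successively_mono)

lemma path_appendD:
  assumes "path E (p @ q)"
  shows "p \<noteq> [] \<Longrightarrow> path E p" "q \<noteq> [] \<Longrightarrow> path E q"
  using assms by (auto simp: path_def successively_append_iff)

lemma path_delete_edge:
  "path E p \<Longrightarrow> x \<notin> set p \<Longrightarrow> path (E - {{x, y}}) p"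
  by (induction p) (auto simp: path_Cons doubleton_eq_iff)

lemma conn_mono: "conn E x y \<Longrightarrow> E \<subseteq> E' \<Longrightarrow> conn E' x y"
  by (erule rtranclp_mono[THEN predicate2D, rotated]) auto

lemma conn_sym: "conn E x y \<Longrightarrow> conn E y x"
proof -
  have "symp (adj E)" by (auto simp: symp_def insert_commute)
  then show "conn E x y \<Longrightarrow> conn E y x"
    by (meson symp_rtranclp sympD)
qed

lemma conn_edge: "conn E x y \<Longrightarrow> {y, z} \<in> E \<Longrightarrow> conn E x z"
  by (simp add: rtranclp.rtrancl_into_rtrancl)

lemma conn_trans: "conn E x y \<Longrightarrow> conn E y z \<Longrightarrow> conn E x z"
  by (rule rtranclp_trans)

lemma successively_conn:
  "successively (adj E) p \<Longrightarrow> p \<noteq> [] \<Longrightarrow> y \<in> set p \<Longrightarrow> conn E (hd p) y"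
proof (induction p)
  case (Cons x p)
  show ?case
  proof (cases "p = [] \<or> y = x")
    case False
    then have "conn E (hd p) y" "{x, hd p} \<in> E"
      using Cons by (auto simp: successively_Cons)
    then show ?thesis by (simp add: converse_rtranclp_into_rtranclp)
  qed (use Cons in auto)
qed simp

lemma path_conn: "path E p \<Longrightarrow> y \<in> set p \<Longrightarrow> conn E (hd p) y"
  by (simp add: path_def successively_conn)

text \<open>Built from the back: when the next vertex already lies on the path made so far, the path
  is cut down to its suffix from that vertex.\<close>

lemma shorten_to_path:
  assumes "successively (adj E) p" "p \<noteq> []"
  obtains q where "path E q" "hd q = hd p" "last q = last p" "length q \<le> length p"
proof -
  have "\<exists>q. path E q \<and> hd q = hd p \<and> last q = last p \<and> length q \<le> length p"
    using assms
  proof (induction p)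
    case (Cons x p)
    show ?case
    proof (cases "p = []")
      case True
      then show ?thesis by (intro exI[of _ "[x]"]) auto
    next
      case False
      then obtain q where q: "path E q" "hd q = hd p" "last q = last p" "length q \<le> length p"
        and e: "{x, hd p} \<in> E"
        using Cons by (auto simp: successively_Cons)
      have ne: "q \<noteq> []" using q(1) by auto
      show ?thesis
      proof (cases "x \<in> set q")
        case True
        then obtain ys zs where s: "q = ys @ x # zs" by (meson split_list)
        then have "path E (x # zs)" using q(1) path_appendD(2) by blast
        then show ?thesis using q s False by (intro exI[of _ "x # zs"]) auto
      next
        case notin: False
        then have "path E (x # q)" using q e by (simp add: path_Cons)
        then show ?thesis using q False ne by (intro exI[of _ "x # q"]) auto
      qed
    qed
  qed simp
  then show thesis using that by blast
qed

lemma conn_path: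
  assumes "conn E x y"
  obtains p where "path E p" "hd p = x" "last p = y"
proof -
  have "\<exists>p. successively (adj E) p \<and> p \<noteq> [] \<and> hd p = x \<and> last p = y"
    using assms
  proof (induction rule: converse_rtranclp_induct)
    case base
    then show ?case by (intro exI[of _ "[y]"]) auto
  next
    case (step a b)
    then obtain p where "successively (adj E) p" "p \<noteq> []" "hd p = b" "last p = y" by blast
    then show ?case using step by (intro exI[of _ "a # p"]) (auto simp: successively_Cons)
  qed
  then show thesis using that shorten_to_path by metis
qed

section \<open>Forests: non-backtracking extension, uniqueness of paths, bridges\<close>

lemma forest_mono: "forest E \<Longrightarrow> E' \<subseteq> E \<Longrightarrow> forest E'"
  unfolding forest_def by (meson path_mono subset_iff)

lemma forest_edge_neq: "forest E \<Longrightarrow> {x, y} \<in> E \<Longrightarrow> x \<noteq> y"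
  by (auto simp: forest_def)

text \<open>In a forest it suffices not to turn back at once: if \<open>x\<close> occurred later on
  \<open>p\<close>, the part of \<open>p\<close> before it would close a cycle with
  \<open>x\<close>.\<close>

lemma forest_path_Cons:
  assumes "forest E" "path E p" "{x, hd p} \<in> E" "tl p \<noteq> [] \<Longrightarrow> hd (tl p) \<noteq> x"
  shows "path E (x # p)"
proof (rule ccontr)
  assume "\<not> path E (x # p)"
  then have "x \<in> set p" using assms by (auto simp: path_Cons)
  then obtain ys zs where s: "p = ys @ x # zs" by (meson split_list)
  have "x \<noteq> hd p" using assms forest_edge_neq by metis
  then have ys: "ys \<noteq> []" using s by auto
  \<comment> \<open>Were \<open>ys\<close> a single vertex, \<open>x\<close> would be the second
    vertex of \<open>p\<close>. So \<open>x # ys\<close> has the three vertices that a cycle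
    needs.\<close>
  have "tl ys \<noteq> []"
  proof
    assume "tl ys = []"
    then obtain y where "ys = [y]" using ys by (cases ys) auto
    then show False using s assms(4) by simp
  qed
  then have len: "length ys \<ge> 2" by (cases ys) (auto simp: Suc_le_eq)
  have "path E ys" using s assms(2) ys path_appendD(1) by blast
  moreover have "x \<notin> set ys" using s assms(2) by (auto simp: path_def)
  ultimately have "path E (x # ys)" using ys s assms(3) by (simp add: path_Cons)
  moreover have "{last (x # ys), hd (x # ys)} \<in> E"
    using s assms(2) ys by (auto simp: path_def successively_append_iff)
  ultimately show False using assms(1) len unfolding forest_def
    by (metis Suc_le_mono length_Cons numeral_2_eq_2 numeral_3_eq_3)
qed

text \<open>The vertices of \<open>p\<close> are moved one by one to the front of the other path,
  each by a non-backtracking extension; hence \<open>x\<close> and \<open>q\<close> vary in the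
  induction.\<close>

lemma forest_path_join:
  assumes "forest E" "path E (x # p)" "path E (x # q)"
    and "p \<noteq> [] \<Longrightarrow> q \<noteq> [] \<Longrightarrow> hd p \<noteq> hd q"
  shows "path E (rev p @ x # q)"
  using assms(2-)
proof (induction p arbitrary: x q)
  case (Cons a p)
  have "path E (a # x # q)"
    using Cons.prems by (intro forest_path_Cons[OF assms(1), of "x # q"])
      (auto simp: path_Cons[of E x "a # p"] insert_commute)
  moreover have "path E (a # p)" "p \<noteq> [] \<Longrightarrow> hd p \<noteq> x"
    using Cons.prems by (auto simp: path_Cons)
  ultimately have "path E (rev p @ a # x # q)"
    by (intro Cons.IH) auto
  then show ?case by simp
qed simp

text \<open>Where two such paths first diverged, their remainders would join to a single path
  meeting the common end vertex twice.\<close>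

lemma forest_path_unique:
  assumes "forest E" "path E p" "path E q" "hd p = hd q" "last p = last q"
  shows "p = q"
  using assms(2-)
proof (induction p arbitrary: q)
  case (Cons x p)
  obtain q' where q: "q = x # q'" using Cons.prems by (cases q) auto
  show ?case
  proof (cases "p = [] \<or> q' = []")
    case True
    then show ?thesis using Cons.prems q by (auto simp: path_def split: if_splits)
  next
    case False
    have "hd p = hd q'"
    proof (rule ccontr)
      assume "hd p \<noteq> hd q'"
      then have "path E (rev p @ x # q')"
        using forest_path_join[OF assms(1)] Cons.prems q by auto
      then have "set p \<inter> set q' = {}" by (auto simp: path_def)
      moreover have "last p = last q'" using False Cons.prems q by simp
      then have "last p \<in> set p" "last p \<in> set q'"
        using False last_in_set by (blast, metis)
      ultimately show False by auto
    qed
    then have "p = q'" using Cons.prems q False by (intro Cons.IH) (auto simp: path_Cons)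
    then show ?thesis using q by simp
  qed
qed simp

lemma forest_bridge:
  assumes "forest E" "{u, v} \<in> E"
  shows "\<not> conn (E - {{u, v}}) u v"
proof
  assume "conn (E - {{u, v}}) u v"
  then obtain p where p: "path (E - {{u, v}}) p" "hd p = u" "last p = v"
    by (rule conn_path)
  then have "p = [u, v]"
    using forest_path_unique[of E p "[u, v]"] path_mono[of _ p E] assms forest_edge_neq[OF assms]
    by (auto simp: path_Cons)
  then show False using p by (simp add: path_Cons)
qed

section \<open>Metric notions in trees\<close>

lemma tree_simple: "tree G \<Longrightarrow> simple_graph G"
  by (simp add: tree_def)

lemma walk_iff:
  assumes "simple_graph G"
  shows "walk G p \<longleftrightarrow> p \<noteq> [] \<and> hd p \<in> verts G \<and> successively (adj (edges G)) p"
proof -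
  have "hd p \<in> verts G \<Longrightarrow> successively (adj (edges G)) p \<Longrightarrow> set p \<subseteq> verts G"
  proof (induction p)
    case (Cons x p)
    have "p \<noteq> [] \<Longrightarrow> {x, hd p} \<subseteq> verts G"
      using Cons.prems assms by (auto simp: simple_graph_def successively_Cons)
    then show ?case using Cons by (cases p) auto
  qed simp
  then show ?thesis unfolding walk_def by (metis hd_in_set subsetD)
qed

lemma walk_betw_iff_conn:
  assumes "simple_graph G" "x \<in> verts G"
  shows "(\<exists>p. walk_betw G x p y) \<longleftrightarrow> conn (edges G) x y"
proof
  assume "\<exists>p. walk_betw G x p y"
  then obtain p where "walk G p" "hd p = x" "last p = y"
    unfolding walk_betw_def by blast
  then show "conn (edges G) x y"
    using successively_conn walk_iff[OF assms(1)] last_in_set by metis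
next
  assume "conn (edges G) x y"
  then obtain p where "path (edges G) p" "hd p = x" "last p = y" by (rule conn_path)
  then show "\<exists>p. walk_betw G x p y"
    using assms unfolding walk_betw_def by (auto simp: walk_iff path_def)
qed

lemma path_verts:
  "simple_graph G \<Longrightarrow> path (edges G) p \<Longrightarrow> hd p \<in> verts G \<Longrightarrow> set p \<subseteq> verts G"
  using walk_iff[of G p] by (auto simp: path_def walk_def)

lemma no_cycle_forest:
  assumes "simple_graph G"
  shows "(\<nexists>p. cycle G p) \<longleftrightarrow> forest (edges G)"
proof -
  have "cycle G p \<longleftrightarrow> path (edges G) p \<and> length p \<ge> 3 \<and> {last p, hd p} \<in> edges G" for p
    using assms unfolding cycle_def walk_iff[OF assms] path_def
    by (auto simp: simple_graph_def)
  then show ?thesis using assms by (auto simp: forest_def simple_graph_def)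
qed

lemma tree_forest: "tree G \<Longrightarrow> forest (edges G)"
  by (simp add: tree_def no_cycle_forest[symmetric])

lemma tree_conn: "tree G \<Longrightarrow> x \<in> verts G \<Longrightarrow> y \<in> verts G \<Longrightarrow> conn (edges G) x y"
  using walk_betw_iff_conn unfolding tree_def connected_graph_def by metis

lemma tree_path_between:
  assumes "tree G" "x \<in> verts G" "y \<in> verts G"
  obtains p where "path (edges G) p" "hd p = x" "last p = y"
  using tree_conn[OF assms] conn_path by metis

text \<open>Every walk with these ends shortens to a path, which by uniqueness is \<open>p\<close>;
  so no walk is shorter than \<open>p\<close>.\<close>

lemma tree_dist:
  assumes "tree G" "path (edges G) p" "hd p \<in> verts G"
  shows "graph_dist G (hd p) (last p) = length p - 1"
  unfolding graph_dist_def
proof (rule Least_equality)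
  note simple = tree_simple[OF assms(1)]
  show "\<exists>q. walk_betw G (hd p) q (last p) \<and> length q = Suc (length p - 1)"
    using assms by (intro exI[of _ p]) (auto simp: walk_betw_def walk_iff[OF simple] path_def)
  fix k
  assume "\<exists>q. walk_betw G (hd p) q (last p) \<and> length q = Suc k"
  then obtain q where q: "walk G q" "hd q = hd p" "last q = last p" "length q = Suc k"
    by (auto simp: walk_betw_def)
  then obtain s where s: "path (edges G) s" "hd s = hd q" "last s = last q" "length s \<le> length q"
    using shorten_to_path[of "edges G" q] walk_iff[OF simple] by blast
  then have "s = p"
    using forest_path_unique[OF tree_forest[OF assms(1)]] assms q by metis
  then show "length p - 1 \<le> k" using s q by simp
qed

lemma finite_verts: "tree G \<Longrightarrow> finite (verts G)"
  by (simp add: tree_def simple_graph_def)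

lemma verts_nonempty: "tree G \<Longrightarrow> verts G \<noteq> {}"
  by (simp add: tree_def connected_graph_def)

text \<open>Turns eccentricities into bounds on path lengths, the form in which the game provides
  them. \<open>Suc n\<close> appears because lists count vertices.\<close>

lemma eccentricity_le_iff:
  assumes "tree G" "v \<in> verts G"
  shows "eccentricity G v \<le> n \<longleftrightarrow> (\<forall>p. path (edges G) p \<longrightarrow> hd p = v \<longrightarrow> length p \<le> Suc n)"
    (is "?L \<longleftrightarrow> ?R")
proof -
  have "?L \<longleftrightarrow> (\<forall>x\<in>verts G. graph_dist G v x \<le> n)"
    using finite_verts[OF assms(1)] assms(2)
    unfolding eccentricity_def by (subst Max_le_iff) auto
  also have "\<dots> \<longleftrightarrow> ?R"
  proof
    assume L: "\<forall>x\<in>verts G. graph_dist G v x \<le> n"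
    show ?R
    proof (intro allI impI)
      fix p
      assume p: "path (edges G) p" "hd p = v"
      then have "last p \<in> verts G"
        using path_verts[OF tree_simple] assms by (metis last_in_set not_path_Nil subsetD)
      then show "length p \<le> Suc n"
        using L tree_dist[OF assms(1) p(1)] p assms(2) by fastforce
    qed
  next
    assume R: ?R
    show "\<forall>x\<in>verts G. graph_dist G v x \<le> n"
    proof
      fix x
      assume "x \<in> verts G"
      then obtain p where "path (edges G) p" "hd p = v" "last p = x"
        using tree_path_between assms by metis
      then show "graph_dist G v x \<le> n"
        using R tree_dist[OF assms(1), of p] assms(2) by fastforce
    qed
  qed
  finally show ?thesis .
qed

lemma length_path_le_eccentricity:
  assumes "tree G" "path (edges G) p" "hd p \<in> verts G"
  shows "length p \<le> Suc (eccentricity G (hd p))"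
  using eccentricity_le_iff[OF assms(1,3), of "eccentricity G (hd p)"] assms(2) by simp

lemma diameter_le_iff:
  assumes "tree G"
  shows "diameter G \<le> n \<longleftrightarrow>
    (\<forall>p. path (edges G) p \<longrightarrow> hd p \<in> verts G \<longrightarrow> length p \<le> Suc n)"
proof -
  have "diameter G \<le> n \<longleftrightarrow> (\<forall>v\<in>verts G. eccentricity G v \<le> n)"
    using finite_verts[OF assms] verts_nonempty[OF assms]
    unfolding diameter_def by (subst Max_le_iff) auto
  then show ?thesis using eccentricity_le_iff[OF assms] by blast
qed

lemma radius_eqI:
  assumes "tree G" "v \<in> verts G" "eccentricity G v = n"
    and "\<And>y. y \<in> verts G \<Longrightarrow> n \<le> eccentricity G y"
  shows "radius G = n"
  unfolding radius_def
  by (rule Min_eqI) (use assms finite_verts in auto)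

section \<open>Locating the centre from the branches at a vertex\<close>

text \<open>Two paths leaving \<open>v\<close> by different neighbours join to one path starting at
  the end of \<open>p\<close>.\<close>

lemma eccentricity_ge_through:
  assumes "tree G" "v \<in> verts G" "path (edges G) (v # p)" "path (edges G) (v # q)"
    and "p \<noteq> []" "q \<noteq> []" "hd p \<noteq> hd q"
  shows "length p + length q \<le> eccentricity G (last p)"
proof -
  let ?s = "rev p @ v # q"
  have s: "path (edges G) ?s"
    using forest_path_join tree_forest assms by metis
  have "last p \<in> verts G"
    using path_verts[OF tree_simple[OF assms(1)] assms(3)] assms(2,5) by auto
  then show ?thesis
    using length_path_le_eccentricity[OF assms(1) s] assms(5) by (simp add: hd_rev)
qed

text \<open>Any other vertex lies outside at least one of the two branches of height
  \<open>n\<close>; the path from it through \<open>v\<close> into that branch has more than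
  \<open>n\<close> edges.\<close>

lemma forked_center:
  assumes "tree G" "v \<in> verts G"
    and le: "\<And>p. path (edges G) p \<Longrightarrow> hd p = v \<Longrightarrow> length p \<le> Suc n"
    and a: "path (edges G) (v # a # p)" "length (a # p) = n"
    and b: "path (edges G) (v # b # q)" "length (b # q) = n"
    and "a \<noteq> b"
  shows "radius G = n" "central_vertices G = {v}"
proof -
  have "eccentricity G v \<le> n" using le eccentricity_le_iff assms(1,2) by metis
  moreover have "n \<le> eccentricity G v"
    using length_path_le_eccentricity[OF assms(1) a(1)] a(2) assms(2) by simp
  ultimately have v: "eccentricity G v = n" by simp
  have other: "n < eccentricity G y" if y: "y \<in> verts G" "y \<noteq> v" for y
  proof -
    obtain s' where "path (edges G) s'" "hd s' = v" "last s' = y"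
      using tree_path_between assms(1,2) y(1) by metis
    then obtain s where s: "path (edges G) (v # s)" "s \<noteq> []" "last s = y"
      using y(2) by (cases s') (auto split: if_splits)
    have "length s + n \<le> eccentricity G y"
    proof (cases "hd s = a")
      case True
      then show ?thesis
        using eccentricity_ge_through[OF assms(1,2) s(1) b(1)] s b(2) \<open>a \<noteq> b\<close> by simp
    next
      case False
      then show ?thesis
        using eccentricity_ge_through[OF assms(1,2) s(1) a(1)] s a(2) by simp
    qed
    then show ?thesis using s(2) by (cases s) auto
  qed
  show r: "radius G = n"
    using v other assms(1,2) by (intro radius_eqI) (auto intro: less_imp_le)
  show "central_vertices G = {v}"
    using v r other assms(2) unfolding central_vertices_def by fastforce
qed

text \<open>The situation of two centres: two branches of height \<open>n\<close> at
  \<open>v\<close> apart from \<open>u\<close>, and a path of \<open>n + 1\<close> edges from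
  \<open>v\<close> through \<open>u\<close>. Other vertices are again far from the end of a branch
  beyond \<open>v\<close>.\<close>

lemma bicentral:
  assumes "tree G" "v \<in> verts G"
    and F: "F = edges G - {{v, u}}"
    and le: "\<And>p. path F p \<Longrightarrow> hd p = v \<Longrightarrow> length p \<le> Suc n"
    and le_u: "\<And>p. path F p \<Longrightarrow> hd p = u \<Longrightarrow> length p \<le> Suc n"
    and a: "path (edges G) (v # a # p)" "length (a # p) = n"
    and b: "path (edges G) (v # b # q)" "length (b # q) = n"
    and "a \<noteq> b"
    and c: "path (edges G) (v # u # s)" "length (u # s) = Suc n"
    and "a \<noteq> u" "b \<noteq> u"
  shows "radius G = Suc n" "central_vertices G = {v, u}"
proof -
  have uv: "{v, u} \<in> edges G" using c by (simp add: path_Cons)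
  then have u: "u \<in> verts G" using tree_simple[OF assms(1)] by (auto simp: simple_graph_def)
  \<comment> \<open>A path from one end of the edge either avoids the edge or crosses it first and
    then runs in \<open>F\<close> from the other end. The form with \<open>x\<close> and
    \<open>y\<close> covers both ends.\<close>
  have ends: "length t \<le> Suc (Suc n)" if t: "path (edges G) t" "hd t = x"
    and x: "{x, y} = {v, u}" for t x y
  proof -
    have F': "F = edges G - {{x, y}}" using F x by simp
    have le': "length t \<le> Suc n" if "path F t" "hd t = x \<or> hd t = y" for t
      using le le_u that x by (auto simp: doubleton_eq_iff)
    obtain t' where t': "t = x # t'" using t by (cases t) auto
    show ?thesis
    proof (cases "t' = []")
      case False
      then have p: "path (edges G) t'" "x \<notin> set t'" "{x, hd t'} \<in> edges G"
        using t t' by (auto simp: path_Cons)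
      then have "path F t'" using path_delete_edge F' by metis
      show ?thesis
      proof (cases "hd t' = y")
        case True
        then show ?thesis using le' \<open>path F t'\<close> t' by fastforce
      next
        case neq: False
        then have "{x, hd t'} \<in> F" using p(3) F' by (auto simp: doubleton_eq_iff)
        then have "path F t" using \<open>path F t'\<close> p t' by (simp add: path_Cons)
        then show ?thesis using le'[of t] t by auto
      qed
    qed (use t' in simp)
  qed
  have "eccentricity G v \<le> Suc n"
    using ends eccentricity_le_iff[OF assms(1,2)] by blast
  moreover have "Suc n \<le> eccentricity G v"
    using length_path_le_eccentricity[OF assms(1) c(1)] c(2) assms(2) by simp
  ultimately have v: "eccentricity G v = Suc n" by simp
  have u_le: "eccentricity G u \<le> Suc n"
    using ends[of _ u v] eccentricity_le_iff[OF assms(1) u] by (metis insert_commute)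
  \<comment> \<open>From \<open>y\<close> one returns to \<open>v\<close> and goes on into a long
    branch: through \<open>u\<close> if \<open>y\<close> is not beyond \<open>u\<close>, and
    otherwise into the branch of \<open>a\<close>, which is one edge shorter.\<close>
  have through: "length t + n \<le> eccentricity G y \<and>
      (hd t \<noteq> u \<longrightarrow> length t + Suc n \<le> eccentricity G y)"
    if t: "path (edges G) (v # t)" "t \<noteq> []" "last t = y" for t y
  proof -
    have "hd t \<noteq> u \<longrightarrow> length t + Suc n \<le> eccentricity G y"
      using eccentricity_ge_through[OF assms(1,2) t(1) c(1)] t c(2) by auto
    moreover have "hd t = u \<longrightarrow> length t + n \<le> eccentricity G y"
      using eccentricity_ge_through[OF assms(1,2) t(1) a(1)] t a(2) \<open>a \<noteq> u\<close> by auto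
    ultimately show ?thesis by fastforce
  qed
  have to_y: "\<exists>t. path (edges G) (v # t) \<and> t \<noteq> [] \<and> last t = y" if y: "y \<in> verts G" "y \<noteq> v" for y
  proof -
    obtain t' where "path (edges G) t'" "hd t' = v" "last t' = y"
      using tree_path_between assms(1,2) y(1) by metis
    then show ?thesis using y(2) by (cases t') (auto split: if_splits)
  qed
  have other: "Suc n \<le> eccentricity G y" if y: "y \<in> verts G" "y \<noteq> v" for y
  proof -
    obtain t where t: "path (edges G) (v # t)" "t \<noteq> []" "last t = y" using to_y[OF y] by blast
    then show ?thesis using through[OF t] by (cases t) auto
  qed
  have strict: "Suc n < eccentricity G y" if y: "y \<in> verts G" "y \<noteq> v" "y \<noteq> u" for y
  proof -
    obtain t where t: "path (edges G) (v # t)" "t \<noteq> []" "last t = y" using to_y[OF y(1,2)] by blast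
    \<comment> \<open>Beyond \<open>u\<close>, a vertex other than \<open>u\<close> is at distance
      at least 2 from \<open>v\<close>, which makes up for the shorter branch.\<close>
    have "hd t = u \<Longrightarrow> 2 \<le> length t" using t(2,3) y(3) by (cases t; cases "tl t") auto
    then show ?thesis using through[OF t] t(2) by (cases t) auto
  qed
  show r: "radius G = Suc n"
  proof (rule radius_eqI[OF assms(1,2) v])
    show "Suc n \<le> eccentricity G y" if "y \<in> verts G" for y
      using v other[OF that] by (cases "y = v") auto
  qed
  have "v \<noteq> u" using c by (auto simp: path_Cons)
  then have "eccentricity G u = Suc n" using u_le other[OF u] by simp
  then show "central_vertices G = {v, u}"
    using v r strict u assms(2) unfolding central_vertices_def by fastforce
qed

lemma degree_eq_card_neighbors: "degree G v = card {x. {v, x} \<in> edges G}"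
  if "simple_graph G"
proof -
  have "\<exists>x. e = {v, x}" if e: "e \<in> edges G" "v \<in> e" for e
  proof -
    have "card e = 2" using e \<open>simple_graph G\<close> by (simp add: simple_graph_def)
    then show ?thesis using e(2) by (auto simp: card_2_iff)
  qed
  then have "{e \<in> edges G. v \<in> e} = (\<lambda>x. {v, x}) ` {x. {v, x} \<in> edges G}"
    by auto
  moreover have "inj_on (\<lambda>x. {v, x}) {x. {v, x} \<in> edges G}"
    by (auto simp: inj_on_def doubleton_eq_iff)
  ultimately show ?thesis unfolding degree_def by (simp add: card_image)
qed

section \<open>Components\<close>

lemma verts_component:
  "simple_graph G \<Longrightarrow> x \<in> verts G \<Longrightarrow> verts (component G x) = {y. conn (edges G) x y}"
  by (simp add: component_def Let_def walk_betw_iff_conn)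

lemma edges_component_subset: "edges (component G x) \<subseteq> edges G"
  by (auto simp: component_def Let_def)

lemma edge_component:
  assumes "simple_graph G" "x \<in> verts G" "conn (edges G) x y" "{y, z} \<in> edges G"
  shows "{y, z} \<in> edges (component G x)"
proof -
  have "conn (edges G) x z" using assms(3,4) by (simp add: conn_edge)
  then show ?thesis
    using assms by (simp add: component_def Let_def walk_betw_iff_conn)
qed

text \<open>A path that starts inside the component has no edge by which to leave it.\<close>

lemma path_component_iff:
  assumes "simple_graph G" "x \<in> verts G" "conn (edges G) x (hd p)"
  shows "path (edges (component G x)) p \<longleftrightarrow> path (edges G) p"
proof
  show "path (edges (component G x)) p \<Longrightarrow> path (edges G) p"
    using path_mono edges_component_subset by metis
  assume "path (edges G) p"
  then show "path (edges (component G x)) p" using assms(3)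
  proof (induction p)
    case (Cons y p)
    show ?case
    proof (cases "p = []")
      case False
      then have e: "{y, hd p} \<in> edges G" and p: "path (edges G) p" "y \<notin> set p"
        using Cons by (auto simp: path_Cons)
      then have "conn (edges G) x (hd p)"
        using Cons.prems by (simp add: conn_edge)
      then show ?thesis
        using Cons e p edge_component[OF assms(1,2)] by (simp add: path_Cons)
    qed simp
  qed simp
qed

lemma tree_component:
  assumes "simple_graph G" "forest (edges G)" "x \<in> verts G"
  shows "tree (component G x)"
proof -
  let ?C = "component G x"
  have sub: "verts ?C \<subseteq> verts G"
    unfolding component_def Let_def walk_betw_def walk_def by auto
  have simple: "simple_graph ?C"
    unfolding simple_graph_def
  proof (intro conjI ballI)
    show "finite (verts ?C)" using assms(1) sub finite_subset by (auto simp: simple_graph_def)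
  next
    fix e
    assume "e \<in> edges ?C"
    then show "e \<subseteq> verts ?C" "card e = 2"
      using assms(1) by (auto simp: simple_graph_def component_def Let_def)
  qed
  have "conn (edges ?C) x y" if y: "y \<in> verts ?C" for y
  proof -
    have "conn (edges G) x y" using y verts_component[OF assms(1,3)] by simp
    then obtain p where p: "path (edges G) p" "hd p = x" "last p = y" by (rule conn_path)
    then have "path (edges ?C) p" using path_component_iff[OF assms(1,3), of p] by simp
    then show ?thesis using path_conn p last_in_set not_path_Nil by metis
  qed
  then have "conn (edges ?C) y z" if "y \<in> verts ?C" "z \<in> verts ?C" for y z
    using that conn_trans[OF conn_sym, of "edges ?C" x y z] by blast
  then have "connected_graph ?C"
    unfolding connected_graph_def
    using walk_betw_iff_conn[OF simple] verts_component[OF assms(1,3)] by auto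
  then show ?thesis
    using simple no_cycle_forest[OF simple] forest_mono[OF assms(2) edges_component_subset]
    by (simp add: tree_def)
qed

section \<open>Races in Trail Trap\<close>

definition P1_winning :: "'a graph \<Rightarrow> ('a move list \<Rightarrow> 'a move) \<Rightarrow> bool" where
  "P1_winning G \<sigma> \<longleftrightarrow> P1_strategy G \<sigma> \<and>
     (\<forall>h. complete_play G h \<and> follows_P1 \<sigma> h \<longrightarrow> odd (length h))"

text \<open>The positions that can arise against \<open>\<sigma>\<close> with Player 1 to move;
  replies of Player 2 are shown to lead from one of them to the next.\<close>

definition P1_turn :: "'a graph \<Rightarrow> ('a move list \<Rightarrow> 'a move) \<Rightarrow> 'a move list \<Rightarrow> bool" where
  "P1_turn G \<sigma> h \<longleftrightarrow> play G h \<and> follows_P1 \<sigma> h \<and> even (length h)"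

text \<open>Without a legal move, \<open>h\<close> would be a complete play of even length, lost by
  Player 1.\<close>

lemma P1_response_legal:
  assumes "P1_winning G \<sigma>" "P1_turn G \<sigma> h"
  shows "legal_move G h (\<sigma> h)"
  using assms unfolding P1_winning_def P1_turn_def P1_strategy_def complete_play_def by blast

lemma play_snoc: "play G (h @ [m]) \<longleftrightarrow> play G h \<and> legal_move G h m"
  unfolding play_def by (auto simp: nth_append less_Suc_eq)

lemma follows_P1_snoc:
  "follows_P1 \<sigma> (h @ [m]) \<longleftrightarrow> follows_P1 \<sigma> h \<and> (even (length h) \<longrightarrow> m = \<sigma> h)"
  unfolding follows_P1_def by (auto simp: nth_append less_Suc_eq)

lemma P1_turn_step:
  assumes "P1_winning G \<sigma>" "P1_turn G \<sigma> h" "legal_move G (h @ [\<sigma> h]) m"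
  shows "P1_turn G \<sigma> (h @ [\<sigma> h, m])"
proof -
  have "P1_turn G \<sigma> ((h @ [\<sigma> h]) @ [m])"
    using assms P1_response_legal[OF assms(1,2)]
    unfolding P1_turn_def play_snoc follows_P1_snoc by simp
  then show ?thesis by simp
qed

lemma used_edges_append: "used_edges (h @ h') = used_edges h \<union> used_edges h'"
  by (auto simp: used_edges_def)

lemma used_edges_Nil [simp]: "used_edges [] = {}"
  by (simp add: used_edges_def)

lemma used_edges_Cons [simp]: "used_edges ((u, v) # h) = insert {u, v} (used_edges h)"
  by (auto simp: used_edges_def)

lemma P1_loses_race:
  assumes "forest (edges G)" "P1_winning G \<sigma>"
    and "P1_turn G \<sigma> (h @ [(w, x), (z, y)])"
    and "E = edges G - used_edges (h @ [(w, x), (z, y)])"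
    and "\<not> conn E x y"
    and "path E (y # p)"
    and "\<And>q. path E q \<Longrightarrow> hd q = x \<Longrightarrow> length q \<le> length (y # p)"
  shows False
  using assms(3-)
proof (induction p arbitrary: h w x z y E)
  case Nil
  let ?h = "h @ [(w, x), (z, y)]"
  \<comment> \<open>The winning strategy must supply a move, but that move is a path with two
    vertices, while the bound is now one.\<close>
  have "legal_move G ?h (\<sigma> ?h)" using P1_response_legal assms(2) Nil by blast
  then have e: "{x, snd (\<sigma> ?h)} \<in> E"
    using Nil(2) by (auto simp: legal_move_def nth_append)
  then have "E \<subseteq> edges G" "{x, snd (\<sigma> ?h)} \<in> edges G" using Nil(2) by auto
  then have "x \<noteq> snd (\<sigma> ?h)" using forest_edge_neq[OF assms(1)] by blast
  then have "path E [x, snd (\<sigma> ?h)]" using e by (simp add: path_Cons)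
  then show ?case using Nil(5) by fastforce
next
  case (Cons y' p)
  let ?h = "h @ [(w, x), (z, y)]"
  have E: "forest E" using Cons.prems(2) forest_mono[OF assms(1)] by blast
  have legal: "legal_move G ?h (\<sigma> ?h)" using P1_response_legal assms(2) Cons.prems(1) by blast
  obtain x' where s: "\<sigma> ?h = (x, x')" and e: "{x, x'} \<in> E"
    using legal Cons.prems(2) by (cases "\<sigma> ?h") (auto simp: legal_move_def nth_append)
  have f: "{y, y'} \<in> E" using Cons.prems(4) by (simp add: path_Cons)
  \<comment> \<open>Each token moves within its own component of \<open>E\<close>, so the separation
    survives the round.\<close>
  have apart: "\<not> conn E x' y" "\<not> conn E x' y'" "\<not> conn E x y'"
  proof -
    have xx': "conn E x x'" and yy': "conn E y' y"
      using e f by (auto simp: insert_commute r_into_rtranclp)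
    show "\<not> conn E x y'" using Cons.prems(3) conn_trans[OF _ yy'] by blast
    then show "\<not> conn E x' y'" using conn_trans[OF xx'] by blast
    show "\<not> conn E x' y" using Cons.prems(3) conn_trans[OF xx'] by blast
  qed
  then have ne: "x \<noteq> y" "x' \<noteq> y" "x \<noteq> y'" "x' \<noteq> y'" using Cons.prems(3) by auto
  have legal': "legal_move G (?h @ [\<sigma> ?h]) (y, y')"
    using f ne Cons.prems(2)
    by (auto simp: legal_move_def s used_edges_append nth_append doubleton_eq_iff)
  let ?E = "E - {{x, x'}, {y, y'}}"
  show ?case
  proof (rule Cons.IH)
    show "P1_turn G \<sigma> (?h @ [(x, x'), (y, y')])"
      using P1_turn_step[OF assms(2) Cons.prems(1) legal'] s by simp
    show "?E = edges G - used_edges (?h @ [(x, x'), (y, y')])"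
      using Cons.prems(2) by (auto simp: used_edges_append)
    show "\<not> conn ?E x' y'" using apart(2) conn_mono[of ?E x' y' E] by blast
    have p: "path E (y' # p)" "y \<notin> set (y' # p)" using Cons.prems(4) by (auto simp: path_Cons)
    have "x \<notin> set (y' # p)"
      using apart(3) path_conn[OF p(1)] conn_sym by fastforce
    then have "path (E - {{x, x'}} - {{y, y'}}) (y' # p)"
      using p by (intro path_delete_edge)
    then show "path ?E (y' # p)" by (rule path_mono) auto
    fix q
    assume q: "path ?E q" "hd q = x'"
    have "path E q" using q(1) by (rule path_mono) auto
    \<comment> \<open>The edge back to \<open>x\<close> has just been used. Hence \<open>x\<close>
      can be put in front of \<open>q\<close>, and the old bound for paths from \<open>x\<close>
      gives the new one, smaller by one.\<close>
    moreover have "tl q \<noteq> [] \<Longrightarrow> hd (tl q) \<noteq> x"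
    proof
      assume "tl q \<noteq> []" "hd (tl q) = x"
      then obtain q' where "q = x' # x # q'" using q(2) by (cases q; cases "tl q") auto
      then show False using q(1) by (simp add: path_Cons insert_commute)
    qed
    ultimately have "path E (x # q)"
      using e q(2) by (intro forest_path_Cons[OF E]) auto
    then show "length q \<le> length (y' # p)" using Cons.prems(5)[of "x # q"] by simp
  qed
qed

section \<open>Replies of Player 2 to a winning opening move\<close>

locale winning_opening =
  fixes G :: "'a graph" and \<sigma> u v F n
  assumes forest: "forest (edges G)"
    and win: "P1_winning G \<sigma>"
    and first_move: "\<sigma> [] = (u, v)"
    and F_def: "F = edges G - {{v, u}}"
    \<comment> \<open>Only an upper bound; where it has to be attained, a path from \<open>v\<close>
      with \<open>Suc n\<close> vertices is given as a hypothesis.\<close>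
    and le: "\<And>p. path F p \<Longrightarrow> hd p = v \<Longrightarrow> length p \<le> Suc n"
begin

lemma forest_F: "forest F"
  using forest_mono[OF forest] F_def by blast

lemma P1_turn_Nil: "P1_turn G \<sigma> []"
  by (simp add: P1_turn_def play_def follows_P1_def)

lemma uv_edge: "{u, v} \<in> edges G"
  using P1_response_legal[OF win P1_turn_Nil] first_move by (simp add: legal_move_def)

lemma reply:
  assumes "{y, z} \<in> F"
  shows "P1_turn G \<sigma> [(u, v), (y, z)]"
    and "edges G - used_edges [(u, v), (y, z)] = F - {{y, z}}"
proof -
  have "legal_move G ([] @ [\<sigma> []]) (y, z)"
    using assms first_move F_def by (auto simp: legal_move_def insert_commute)
  from P1_turn_step[OF win P1_turn_Nil this] show "P1_turn G \<sigma> [(u, v), (y, z)]"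
    by (simp add: first_move)
  show "edges G - used_edges [(u, v), (y, z)] = F - {{y, z}}"
    using F_def by (auto simp: insert_commute)
qed

lemma not_conn: "\<not> conn F u v"
  using forest_bridge[OF forest uv_edge] F_def by (simp add: insert_commute)

text \<open>Otherwise Player 2 starts along \<open>p\<close>. After its first edge at least
  \<open>Suc n\<close> vertices remain, no fewer than on any path open to Player 1 from
  \<open>v\<close>, and the opening edge separates the tokens. As \<open>p\<close> may start
  anywhere on the side of \<open>u\<close>, this bounds the diameter of that side.\<close>

lemma far_side:
  assumes "path F p" "conn F u (hd p)"
  shows "length p \<le> Suc n"
proof (rule ccontr)
  assume long: "\<not> length p \<le> Suc n"
  then obtain y z q where p: "p = y # z # q" by (cases p; cases "tl p") auto
  then have yz: "{y, z} \<in> F" using assms(1) by (simp add: path_Cons)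
  show False
  proof (rule P1_loses_race[OF forest win, of "[]" u v y z])
    show "P1_turn G \<sigma> ([] @ [(u, v), (y, z)])" using reply[OF yz] by simp
    show "F - {{y, z}} = edges G - used_edges ([] @ [(u, v), (y, z)])" using reply[OF yz] by simp
    show "\<not> conn (F - {{y, z}}) v z"
    proof
      assume "conn (F - {{y, z}}) v z"
      then have "conn F v z" by (rule conn_mono) auto
      moreover have "conn F u z"
        using yz assms(2) p by (simp add: conn_edge)
      ultimately show False using not_conn conn_trans[OF _ conn_sym, of F u z v] by blast
    qed
    show "path (F - {{y, z}}) (z # q)"
      using assms(1) p by (intro path_delete_edge) (auto simp: path_Cons)
    fix s
    assume "path (F - {{y, z}}) s" "hd s = v"
    then have "length s \<le> Suc n" using le path_mono by (metis Diff_subset)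
    then show "length s \<le> length (z # q)" using long p by simp
  qed
qed

text \<open>Player 2 would otherwise step from \<open>v\<close> to \<open>a\<close>. The used edge
  is a bridge, Player 2 still has a path of \<open>n\<close> vertices, and Player 1, left at
  \<open>v\<close>, has none longer.\<close>

lemma second_branch:
  assumes "path F (v # a # p)" "length (a # p) = n"
  obtains b q where "path F (v # b # q)" "length (b # q) = n" "a \<noteq> b"
proof (rule ccontr)
  assume "\<not> thesis"
  then have none: "\<not> (path F (v # b # q) \<and> length (b # q) = n \<and> a \<noteq> b)" for b q
    using that by blast
  have va: "{v, a} \<in> F" using assms(1) by (simp add: path_Cons)
  show False
  proof (rule P1_loses_race[OF forest win, of "[]" u v v a])
    show "P1_turn G \<sigma> ([] @ [(u, v), (v, a)])" using reply[OF va] by simp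
    show "F - {{v, a}} = edges G - used_edges ([] @ [(u, v), (v, a)])" using reply[OF va] by simp
    show "\<not> conn (F - {{v, a}}) v a" using forest_bridge[OF forest_F va] .
    show "path (F - {{v, a}}) (a # p)"
      using assms(1) by (intro path_delete_edge) (auto simp: path_Cons)
    fix s
    assume s: "path (F - {{v, a}}) s" "hd s = v"
    then have F: "path F s" using path_mono by (metis Diff_subset)
    show "length s \<le> length (a # p)"
    proof (rule ccontr)
      assume "\<not> length s \<le> length (a # p)"
      \<comment> \<open>A longer path would start with a neighbour other than \<open>a\<close>, the
        edge to \<open>a\<close> being used, and so exhibit a second branch of height
        \<open>n\<close>.\<close>
      then have "length s = Suc n" using le[OF F s(2)] assms(2) by simp
      then obtain b q where bq: "s = v # b # q" "length (b # q) = n"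
        using s(2) assms(2) by (cases s; cases "tl s") auto
      moreover from this have "a \<noteq> b" using s(1) by (auto simp: path_Cons)
      ultimately show False using F none by blast
    qed
  qed
qed

text \<open>From a third neighbour \<open>c\<close>, Player 2 moves to \<open>v\<close>, where the
  token of Player 1 stands. Player 1 must enter some branch, and Player 2 then takes one of the
  branches of \<open>a\<close> and \<open>b\<close> that Player 1 did not take.\<close>

lemma no_third_branch:
  assumes a: "path F (v # a # p)" "length (a # p) = n"
    and b: "path F (v # b # q)" "length (b # q) = n"
    and "a \<noteq> b" "{v, c} \<in> F"
  shows "c = a \<or> c = b"
proof (rule ccontr)
  assume c: "\<not> (c = a \<or> c = b)"
  have cv: "{c, v} \<in> F" using assms by (simp add: insert_commute)
  let ?h = "[(u, v), (c, v)]"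
  have turn: "P1_turn G \<sigma> ?h" and used: "edges G - used_edges ?h = F - {{c, v}}"
    using reply[OF cv] by auto
  have legal: "legal_move G ?h (\<sigma> ?h)" using P1_response_legal[OF win turn] .
  obtain z where s: "\<sigma> ?h = (v, z)" and "{v, z} \<in> F - {{c, v}}"
    using legal used by (cases "\<sigma> ?h") (auto simp: legal_move_def)
  then have vz: "{v, z} \<in> F" by simp
  \<comment> \<open>\<open>z\<close> may be \<open>a\<close>, \<open>b\<close> or yet another
    neighbour; in each case \<open>a\<close> or \<open>b\<close> is still free, and neither of them
    is \<open>c\<close>.\<close>
  obtain d t where d: "path F (v # d # t)" "length (d # t) = n" "d \<noteq> z" "d \<noteq> c"
    using a b c \<open>a \<noteq> b\<close> by metis
  have vd: "{v, d} \<in> F" using d by (simp add: path_Cons)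
  have "{v, d} \<in> edges G - used_edges ?h - {{v, z}}"
    using used vd d by (auto simp: doubleton_eq_iff)
  then have legal': "legal_move G (?h @ [\<sigma> ?h]) (v, d)"
    by (auto simp: legal_move_def s used_edges_append)
  let ?E = "F - {{c, v}} - {{v, z}} - {{v, d}}"
  show False
  proof (rule P1_loses_race[OF forest win, of ?h v z v d])
    show "P1_turn G \<sigma> (?h @ [(v, z), (v, d)])"
      using P1_turn_step[OF win turn legal'] s by simp
    show "?E = edges G - used_edges (?h @ [(v, z), (v, d)])"
    proof -
      have "edges G - used_edges (?h @ [(v, z), (v, d)]) =
          (edges G - used_edges ?h) - used_edges [(v, z), (v, d)]"
        unfolding used_edges_append by blast
      then show ?thesis unfolding used by auto
    qed
    show "\<not> conn ?E z d"
    proof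
      assume "conn ?E z d"
      \<comment> \<open>The edge from \<open>d\<close> to \<open>v\<close> is put back: together
        with the supposed connection it would bypass the bridge from \<open>z\<close> to
        \<open>v\<close>.\<close>
      then have "conn (F - {{z, v}}) z d" by (rule conn_mono) (auto simp: insert_commute)
      moreover have "{d, v} \<in> F - {{z, v}}"
        using vd d by (auto simp: insert_commute doubleton_eq_iff)
      ultimately have "conn (F - {{z, v}}) z v" by (rule conn_edge)
      then show False using forest_bridge[OF forest_F, of z v] vz by (simp add: insert_commute)
    qed
    have "path F (d # t)" "v \<notin> set (d # t)" using d by (auto simp: path_Cons)
    then show "path ?E (d # t)"
      by (metis path_delete_edge insert_commute)
    fix w
    assume w: "path ?E w" "hd w = z"
    have "path F w" using w(1) by (rule path_mono) auto
    moreover have "tl w \<noteq> [] \<Longrightarrow> hd (tl w) \<noteq> v"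
    proof
      assume "tl w \<noteq> []" "hd (tl w) = v"
      then obtain w' where "w = z # v # w'" using w(2) by (cases w; cases "tl w") auto
      then show False using w(1) by (simp add: path_Cons insert_commute)
    qed
    \<comment> \<open>With \<open>v\<close> in front, \<open>w\<close> falls under the bound
      \<open>Suc n\<close>, so \<open>w\<close> has at most \<open>n\<close> vertices, as many as
      Player 2 has left.\<close>
    ultimately have "path F (v # w)"
      using vz w(2) by (intro forest_path_Cons[OF forest_F]) auto
    then show "length w \<le> length (d # t)" using le[of "v # w"] d(2) by simp
  qed
qed

end

section \<open>The theorem\<close>

theorem theorem4p5:
  fixes T :: "'a graph" and r :: nat
  assumes "tree T"
    and "card (verts T) \<noteq> 2"
    and "P1_win T"
    and "radius T = r"
  shows "(\<forall>c. central_vertices T = {c} \<longrightarrow>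
            degree T c = 3 \<and>
            (\<exists>x. {c, x} \<in> edges T \<and>
               diameter (component (delete_edge T {c, x}) x) \<le> r \<and>
               central_vertices (component (delete_edge T {c, x}) c) = {c})) \<and>
         (\<forall>c1 c2. c1 \<noteq> c2 \<and> central_vertices T = {c1, c2} \<and> degree T c1 \<ge> degree T c2 \<longrightarrow>
            degree T c1 = 3 \<and> degree T c2 = 2 \<and>
            diameter (component (delete_edge T {c1, c2}) c2) \<le> r - 1 \<and>
            central_vertices (component (delete_edge T {c1, c2}) c1) = {c1})"
proof -
  note forest = tree_forest[OF assms(1)] and simple = tree_simple[OF assms(1)]
  obtain \<sigma> where win: "P1_winning T \<sigma>"
    using assms(3) unfolding P1_win_def P1_winning_def by blast
  obtain u v where first_move: "\<sigma> [] = (u, v)" by fastforce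
  define D where "D = delete_edge T {v, u}"
  define F where F_edges: "F = edges D"
  have F: "F = edges T - {{v, u}}" by (simp add: F_edges D_def delete_edge_def)
  have D: "simple_graph D" "verts D = verts T" "forest (edges D)"
    using simple forest_mono[OF forest, of "edges D"] F
    by (auto simp: D_def delete_edge_def simple_graph_def)
  have "P1_turn T \<sigma> []" by (simp add: P1_turn_def play_def follows_P1_def)
  from P1_response_legal[OF win this] have vu: "{v, u} \<in> edges T"
    using first_move by (simp add: legal_move_def insert_commute)
  then have verts: "v \<in> verts T" "u \<in> verts T" using simple by (auto simp: simple_graph_def)
  have "v \<noteq> u" using forest_edge_neq[OF forest vu] .
  define V where "V = component D v"
  define U where "U = component D u"
  have V: "tree V" "v \<in> verts V" and U: "tree U"
    using tree_component[OF D(1,3)] verts_component[OF D(1)] D(2) verts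
    by (auto simp: V_def U_def)
  have path_V: "path (edges V) p \<longleftrightarrow> path F p" if "hd p = v" for p
    using path_component_iff[OF D(1), of v p] that verts D(2) by (simp add: V_def F_edges)
  \<comment> \<open>As the eccentricity of \<open>v\<close> on its own side of the opening edge,
    \<open>n\<close> is attained by some path from \<open>v\<close>, not just an upper
    bound.\<close>
  define n where "n = eccentricity V v"
  have le: "length p \<le> Suc n" if "path F p" "hd p = v" for p
    using length_path_le_eccentricity[OF V(1), of p] path_V that V(2) by (simp add: n_def)
  interpret winning_opening T \<sigma> u v F n
    by unfold_locales (use forest win first_move F le in auto)
  have le_u: "length p \<le> Suc n" if "path F p" "hd p = u" for p
    using far_side that by simp
  \<comment> \<open>For \<open>n = 0\<close> neither end of the opening edge has a further edge, so
    the tree is a single edge. There Player 1 wins at once; the assumption on the number of vertices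
    excludes it.\<close>
  have "n \<noteq> 0"
  proof
    assume n0: "n = 0"
    have iso: "{x, y} \<notin> F" if "x = v \<or> x = u" for x y
    proof
      assume e: "{x, y} \<in> F"
      then have "path F [x, y]" using forest_edge_neq[OF forest_F e] by (simp add: path_Cons)
      then show False using le[of "[x, y]"] le_u[of "[x, y]"] that n0 by auto
    qed
    have "y \<in> {v, u}" if "y \<in> verts T" for y
    proof -
      have "conn (edges T) v y" using tree_conn[OF assms(1)] verts that by blast
      then show ?thesis
      proof (induction rule: rtranclp_induct)
        case (step y z)
        then have "{y, z} = {v, u}" using iso F by blast
        then show ?case by auto
      qed simp
    qed
    then have "verts T = {v, u}" using verts by auto
    then show False using assms(2) \<open>v \<noteq> u\<close> by simp
  qed
  have "\<not> eccentricity V v \<le> n - 1" using \<open>n \<noteq> 0\<close> n_def by simp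
  then obtain p' where p': "path F p'" "hd p' = v" "\<not> length p' \<le> Suc (n - 1)"
    unfolding eccentricity_le_iff[OF V] using path_V by blast
  then have "length p' = Suc n" using le[of p'] by simp
  then obtain a p where a: "path F (v # a # p)" "length (a # p) = n"
    using p' \<open>n \<noteq> 0\<close> by (cases p'; cases "tl p'") auto
  obtain b q where b: "path F (v # b # q)" "length (b # q) = n" "a \<noteq> b"
    using second_branch[OF a] by blast
  have T_path: "path F p \<Longrightarrow> path (edges T) p" for p
    by (rule path_mono) (auto simp: F)
  have ab: "{v, a} \<in> F" "{v, b} \<in> F" using a b by (auto simp: path_Cons)
  then have "a \<noteq> u" "b \<noteq> u" using F by auto
  have "{x. {v, x} \<in> edges T} = {u, a, b}"
    using no_third_branch[OF a b] ab vu F by (auto simp: doubleton_eq_iff)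
  then have deg_v: "degree T v = 3"
    using degree_eq_card_neighbors[OF simple, of v] \<open>a \<noteq> u\<close> \<open>b \<noteq> u\<close> \<open>a \<noteq> b\<close> by auto
  have center_V: "central_vertices V = {v}"
    using forked_center(2)[OF V, of n a p b q] le a b path_V by auto
  have diam_U: "diameter U \<le> n"
    unfolding diameter_le_iff[OF U]
  proof (intro allI impI)
    fix s
    assume s: "path (edges U) s" "hd s \<in> verts U"
    then have "conn F u (hd s)"
      using verts_component[OF D(1), of u] D(2) verts unfolding U_def F_edges by simp
    moreover from this have "path F s"
      using s(1) path_component_iff[OF D(1), of u s] D(2) verts by (simp add: U_def F_edges)
    ultimately show "length s \<le> Suc n" using far_side by blast
  qed
  show ?thesis
  \<comment> \<open>The side of \<open>u\<close> has height at most \<open>n\<close> seen from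
    \<open>u\<close>. If that height is attained, \<open>v\<close> and \<open>u\<close> are the two
    centres and the radius is \<open>n + 1\<close>; otherwise \<open>v\<close> is the only centre
    and the radius is \<open>n\<close>.\<close>
  proof (cases "\<exists>s. path (edges T) (v # u # s) \<and> length (u # s) = Suc n")
    case True
    then obtain s where s: "path (edges T) (v # u # s)" "length (u # s) = Suc n" by blast
    note bi = bicentral[OF assms(1) verts(1) F _ _ T_path[OF a(1)] a(2) T_path[OF b(1)] b(2)
        \<open>a \<noteq> b\<close> s \<open>a \<noteq> u\<close> \<open>b \<noteq> u\<close>]
    have center: "central_vertices T = {v, u}" by (rule bi(2)) (fact le le_u)+
    have r: "r = Suc n" unfolding assms(4)[symmetric] by (rule bi(1)) (fact le le_u)+
    obtain w t where w: "s = w # t" using s(2) \<open>n \<noteq> 0\<close> by (cases s) auto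
    have uw: "path F (u # w # t)" "w \<noteq> v" "{u, w} \<in> edges T"
      using s(1) w path_delete_edge[of "edges T" "u # w # t" v u] F by (auto simp: path_Cons)
    \<comment> \<open>A third neighbour of \<open>u\<close> would extend the path of
      \<open>n + 1\<close> vertices from \<open>u\<close> to one of \<open>n + 2\<close> on the side
      of \<open>u\<close>, against the bound for that side.\<close>
    have "x = v \<or> x = w" if x: "{u, x} \<in> edges T" for x
    proof (rule ccontr)
      assume neq: "\<not> (x = v \<or> x = w)"
      have "{x, u} \<in> F" using x neq F by (auto simp: insert_commute doubleton_eq_iff)
      then have "path F (x # u # w # t)"
        using uw(1) neq by (intro forest_path_Cons[OF forest_F, of "u # w # t"]) auto
      moreover have "conn F u x"
        using \<open>{x, u} \<in> F\<close> by (simp add: insert_commute r_into_rtranclp)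
      ultimately have "length (x # u # w # t) \<le> Suc n" using far_side by fastforce
      then show False using s(2) w by simp
    qed
    then have "{x. {u, x} \<in> edges T} = {v, w}"
      using vu uw(3) by (auto simp: insert_commute)
    then have deg_u: "degree T u = 2"
      using degree_eq_card_neighbors[OF simple, of u] uw(2) by auto
    show ?thesis
    proof (intro conjI allI impI)
      fix c
      assume "central_vertices T = {c}"
      then have False using center \<open>v \<noteq> u\<close> by auto
      then show "degree T c = 3" "\<exists>x. {c, x} \<in> edges T \<and>
          diameter (component (delete_edge T {c, x}) x) \<le> r \<and>
          central_vertices (component (delete_edge T {c, x}) c) = {c}" by auto
    next
      fix c1 c2
      assume "c1 \<noteq> c2 \<and> central_vertices T = {c1, c2} \<and> degree T c1 \<ge> degree T c2"
      \<comment> \<open>The degrees 3 and 2 decide which centre is which.\<close>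
      then have "c1 = v" "c2 = u" using center deg_u deg_v by (auto simp: doubleton_eq_iff)
      then show "degree T c1 = 3" "degree T c2 = 2"
        "diameter (component (delete_edge T {c1, c2}) c2) \<le> r - 1"
        "central_vertices (component (delete_edge T {c1, c2}) c1) = {c1}"
        using deg_u deg_v diam_U center_V r by (simp_all add: U_def V_def D_def)
    qed
  next
    case False
    \<comment> \<open>A path from \<open>v\<close> outside \<open>F\<close> begins with the opening
      edge. Its rest starts at \<open>u\<close> and has at most \<open>n + 1\<close> vertices, and
      exactly \<open>n + 1\<close> is excluded in this case.\<close>
    have le_T: "length s \<le> Suc n" if s: "path (edges T) s" "hd s = v" for s
    proof (cases "path F s")
      case True
      then show ?thesis using le s by blast
    next
      case not_F: False
      obtain s' where s': "s = v # s'" "s' \<noteq> []"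
        using s not_F by (cases s) (auto simp: path_Cons)
      then have "path (edges T) s'" "v \<notin> set s'" using s by (auto simp: path_Cons)
      then have "path F s'" using path_delete_edge F by metis
      then have "{v, hd s'} \<notin> F" using not_F s' \<open>v \<notin> set s'\<close> by (simp add: path_Cons)
      then have "hd s' = u" using s s' F by (auto simp: path_Cons doubleton_eq_iff)
      then obtain s'' where s'': "s' = u # s''" using s' by (cases s') auto
      have "length s' \<noteq> Suc n" using False s s' s'' by auto
      moreover have "length s' \<le> Suc n" using le_u \<open>path F s'\<close> \<open>hd s' = u\<close> by blast
      ultimately show ?thesis using s' by simp
    qed
    note fc = forked_center[OF assms(1) verts(1) _ T_path[OF a(1)] a(2) T_path[OF b(1)] b(2)
        \<open>a \<noteq> b\<close>]
    have center: "central_vertices T = {v}" by (rule fc(2)) (fact le_T)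
    have r: "r = n" unfolding assms(4)[symmetric] by (rule fc(1)) (fact le_T)
    show ?thesis
      using center r deg_v vu diam_U center_V by (auto simp: U_def V_def D_def)
  qed
qed

end
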